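(* Let $V=(\mathbb{F}_2)^r$, $W=(\mathbb{F}_2)^s$ with $s>r$, let $\alpha:V\to W$ be injective, and let $\sigma\in\mathrm{Sym}(V)$ be linearly extendible via $\alpha$. Let $T=\langle\alpha(V)\rangle$ and let $\sigma':W\to W$ be defined as follows: for $t\in T$ written as $t=\sum_{j=1}^{\iota}\alpha(v^j)$ with $v^j\in V$, set $\sigma'(t)=\sum_{j=1}^{\iota}\alpha(\sigma(v^j))$; fix a subset $B$ of the standard basis $\{\mathbf e_1,\dots,\mathbf e_s\}$ of $W$ with $|B|=s-\dim T$ and $W=T\oplus\langle B\rangle$, and for $w=w_T+w_B$ with $w_T\in T$, $w_B\in\langle B\rangle$ set $\sigma'(w)=\sigma'(w_T)+w_B$. Then $\sigma'$ is well defined and $\sigma'\in\mathrm{GL}(W)$.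
   Context: For $\sigma\in\mathrm{Sym}(V)$ and injective $\alpha:V\to W$, $\sigma$ is called linearly extendible via $\alpha$ if for every finite family $\{v^i\}_{i\in I}\subset V$ one has $\sum_{i\in I}\alpha(v^i)=0\iff\sum_{i\in I}\alpha(\sigma(v^i))=0$. *)

theory Defs
  imports "HOL-Analysis.Analysis" "HOL-Library.Z2"
begin

text \<open>sigma is linearly extendible via alpha: for every finite family (v i) indexed by i in I,
  the sum of alpha (v i) vanishes iff the sum of alpha (sigma (v i)) vanishes.\<close>
definition linearly_extendible ::
  "('v \<Rightarrow> 'v) \<Rightarrow> ('v \<Rightarrow> 'w::comm_monoid_add) \<Rightarrow> bool" where
  "linearly_extendible \<sigma> \<alpha> \<longleftrightarrow>
     (\<forall>(I::nat set) (v::nat \<Rightarrow> 'v). finite I \<longrightarrow>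
        ((\<Sum>i\<in>I. \<alpha> (v i)) = 0 \<longleftrightarrow> (\<Sum>i\<in>I. \<alpha> (\<sigma> (v i))) = 0))"

end

theory Submission imports Defs begin

text \<open>Over \<open>\<bbbF>\<^sub>2\<close> every element of \<open>T = \<langle>\<alpha>(V)\<rangle>\<close> is a sum of a finite family
  \<open>\<alpha>(v\<^sup>j)\<close>, and two families with the same sum can be concatenated into one family with
  sum \<open>0\<close> (since \<open>x + x = 0\<close>). Linear extendibility therefore makes
  \<open>\<Sum> \<alpha>(v\<^sup>j) \<mapsto> \<Sum> \<alpha>(\<sigma>(v\<^sup>j))\<close> a well-defined additive map on \<open>T\<close>, injective by the converse
  direction of extendibility and onto \<open>T\<close> because \<open>\<sigma>\<close> is onto. Any bijective linear map
  of a subspace extends to a linear automorphism of the whole space by the identity on a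
  complement.\<close>

lemma vec_bit_uminus [simp]: "- (x::bit ^ 'n) = x"
  by (simp add: vec_eq_iff)

lemma vec_bit_add_self [simp]: "(x::bit ^ 'n) + x = 0"
  by (metis add.right_inverse diff_conv_add_uminus vec_bit_uminus)

lemma vec_bit_add_eq_0_iff: "(x::bit ^ 'n) + y = 0 \<longleftrightarrow> x = y"
  by (metis add_eq_0_iff vec_bit_uminus)

lemma vec_bit_scale_commute:
  fixes f :: "bit ^ 'm \<Rightarrow> bit ^ 'n"
  assumes "f 0 = 0"
  shows "f (c *s x) = c *s f x"
  using assms by (cases "c = 0") auto

lemma sum_family_concat:
  fixes v u :: "nat \<Rightarrow> 'a"
  assumes "finite I" "finite J"
  obtains K :: "nat set" and w where "finite K"
    "\<And>h :: 'a \<Rightarrow> 'b::comm_monoid_add. (\<Sum>k\<in>K. h (w k)) = (\<Sum>i\<in>I. h (v i)) + (\<Sum>j\<in>J. h (u j))"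
proof -
  define K where "K = (\<lambda>i. 2 * i) ` I \<union> (\<lambda>j. Suc (2 * j)) ` J"
  define w where "w k = (if even k then v (k div 2) else u (k div 2))" for k
  have disjoint: "(\<lambda>i. 2 * i) ` I \<inter> (\<lambda>j. Suc (2 * j)) ` J = {}"
    by auto presburger
  have "(\<Sum>k\<in>K. h (w k)) = (\<Sum>i\<in>I. h (v i)) + (\<Sum>j\<in>J. h (u j))" for h :: "'a \<Rightarrow> 'b"
  proof -
    have "(\<Sum>k\<in>K. h (w k))
        = (\<Sum>k\<in>(\<lambda>i. 2 * i) ` I. h (w k)) + (\<Sum>k\<in>(\<lambda>j. Suc (2 * j)) ` J. h (w k))"
      unfolding K_def using assms disjoint by (simp add: sum.union_disjoint)
    also have "\<dots> = (\<Sum>i\<in>I. h (v i)) + (\<Sum>j\<in>J. h (u j))"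
      by (simp add: sum.reindex inj_on_def w_def)
    finally show ?thesis .
  qed
  moreover have "finite K" using assms by (simp add: K_def)
  ultimately show thesis using that by blast
qed

lemma sum_in_span_range: "(\<Sum>i\<in>I. \<alpha> (v i)) \<in> vec.span (range \<alpha>)"
  by (rule vec.span_sum) (auto intro: vec.span_base)

lemma span_range_bit_eq_sums:
  fixes \<alpha> :: "'a \<Rightarrow> bit ^ 'n"
  shows "vec.span (range \<alpha>) = {\<Sum>i<n. \<alpha> (v i) | (n::nat) v. True}"
proof
  show "vec.span (range \<alpha>) \<subseteq> {\<Sum>i<n. \<alpha> (v i) | (n::nat) v. True}"
  proof
    fix t assume "t \<in> vec.span (range \<alpha>)"
    then show "t \<in> {\<Sum>i<n. \<alpha> (v i) | (n::nat) v. True}"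
    proof (induction rule: vec.span_induct_alt)
      case base
      have "0 = (\<Sum>i<(0::nat). \<alpha> (undefined i))" by simp
      then show ?case by blast
    next
      case (step c x y)
      then obtain n :: nat and v a where y: "y = (\<Sum>i<n. \<alpha> (v i))" and x: "x = \<alpha> a" by blast
      have "c *s x + y = y \<or> c *s x + y = (\<Sum>i<Suc n. \<alpha> ((v(n := a)) i))"
        using x y by (cases "c = 0") (auto simp: add.commute)
      then show ?case unfolding mem_Collect_eq using y by blast
    qed
  qed
  show "{\<Sum>i<n. \<alpha> (v i) | (n::nat) v. True} \<subseteq> vec.span (range \<alpha>)"
    by (auto intro: sum_in_span_range)
qed

lemma linearly_extendible_sums_eq:
  fixes \<alpha> :: "'v \<Rightarrow> bit ^ 'n" and I J :: "nat set"
  assumes "linearly_extendible \<sigma> \<alpha>" "finite I" "finite J"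
    and "(\<Sum>i\<in>I. \<alpha> (v i)) = (\<Sum>j\<in>J. \<alpha> (u j))"
  shows "(\<Sum>i\<in>I. \<alpha> (\<sigma> (v i))) = (\<Sum>j\<in>J. \<alpha> (\<sigma> (u j)))"
proof -
  obtain K :: "nat set" and w where "finite K"
    and concat: "\<And>h :: 'v \<Rightarrow> bit ^ 'n. (\<Sum>k\<in>K. h (w k)) = (\<Sum>i\<in>I. h (v i)) + (\<Sum>j\<in>J. h (u j))"
    using sum_family_concat[OF assms(2,3)] by metis
  have "(\<Sum>k\<in>K. \<alpha> (w k)) = 0"
    using concat[of \<alpha>] assms(4) by simp
  then have "(\<Sum>k\<in>K. \<alpha> (\<sigma> (w k))) = 0"
    using assms(1) \<open>finite K\<close> unfolding linearly_extendible_def by blast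
  then show ?thesis
    using concat[of "\<lambda>x. \<alpha> (\<sigma> x)"] by (simp add: vec_bit_add_eq_0_iff)
qed

text \<open>Off the span no family represents \<open>t\<close>, so the value there is an arbitrary junk value.\<close>

definition induced_map :: "('v \<Rightarrow> 'v) \<Rightarrow> ('v \<Rightarrow> bit ^ 'n) \<Rightarrow> bit ^ 'n \<Rightarrow> bit ^ 'n" where
  "induced_map \<sigma> \<alpha> t =
     (SOME y. \<exists>(I::nat set) v. finite I \<and> t = (\<Sum>i\<in>I. \<alpha> (v i)) \<and> y = (\<Sum>i\<in>I. \<alpha> (\<sigma> (v i))))"

context
  fixes \<sigma> :: "'v \<Rightarrow> 'v" and \<alpha> :: "'v \<Rightarrow> bit ^ 'n"
  assumes extendible: "linearly_extendible \<sigma> \<alpha>"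
begin

lemma induced_map_sum:
  fixes I :: "nat set"
  assumes "finite I"
  shows "induced_map \<sigma> \<alpha> (\<Sum>i\<in>I. \<alpha> (v i)) = (\<Sum>i\<in>I. \<alpha> (\<sigma> (v i)))"
proof -
  let ?P = "\<lambda>y. \<exists>(J::nat set) u. finite J \<and> (\<Sum>i\<in>I. \<alpha> (v i)) = (\<Sum>j\<in>J. \<alpha> (u j))
                    \<and> y = (\<Sum>j\<in>J. \<alpha> (\<sigma> (u j)))"
  have "?P (\<Sum>i\<in>I. \<alpha> (\<sigma> (v i)))" using assms by blast
  then have "?P (induced_map \<sigma> \<alpha> (\<Sum>i\<in>I. \<alpha> (v i)))"
    unfolding induced_map_def by (rule someI)
  then show ?thesis
    using linearly_extendible_sums_eq[OF extendible assms] by metis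
qed

lemma induced_map_lessThan_sum:
  fixes n :: nat
  shows "induced_map \<sigma> \<alpha> (\<Sum>i<n. \<alpha> (v i)) = (\<Sum>i<n. \<alpha> (\<sigma> (v i)))"
  by (rule induced_map_sum) simp

lemma induced_map_add:
  assumes "x \<in> vec.span (range \<alpha>)" "y \<in> vec.span (range \<alpha>)"
  shows "induced_map \<sigma> \<alpha> (x + y) = induced_map \<sigma> \<alpha> x + induced_map \<sigma> \<alpha> y"
proof -
  obtain n m :: nat and v u where x: "x = (\<Sum>i<n. \<alpha> (v i))" and y: "y = (\<Sum>i<m. \<alpha> (u i))"
    using assms by (auto simp: span_range_bit_eq_sums)
  obtain K :: "nat set" and w where "finite K"
    and concat: "\<And>h :: 'v \<Rightarrow> bit ^ 'n. (\<Sum>k\<in>K. h (w k)) = (\<Sum>i<n. h (v i)) + (\<Sum>i<m. h (u i))"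
    using sum_family_concat[of "{..<n}" "{..<m}"] by blast
  have "induced_map \<sigma> \<alpha> (x + y) = induced_map \<sigma> \<alpha> (\<Sum>k\<in>K. \<alpha> (w k))"
    using concat[of \<alpha>] by (simp add: x y)
  also have "\<dots> = (\<Sum>k\<in>K. \<alpha> (\<sigma> (w k)))"
    using \<open>finite K\<close> by (rule induced_map_sum)
  also have "\<dots> = induced_map \<sigma> \<alpha> x + induced_map \<sigma> \<alpha> y"
    using concat[of "\<lambda>z. \<alpha> (\<sigma> z)"] by (simp add: x y induced_map_lessThan_sum)
  finally show ?thesis .
qed

lemma induced_map_unique_on_span:
  assumes "\<forall>(I::nat set) v. finite I \<longrightarrow> g (\<Sum>i\<in>I. \<alpha> (v i)) = (\<Sum>i\<in>I. \<alpha> (\<sigma> (v i)))"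
    and "t \<in> vec.span (range \<alpha>)"
  shows "g t = induced_map \<sigma> \<alpha> t"
proof -
  obtain n :: nat and v where "t = (\<Sum>i<n. \<alpha> (v i))"
    using assms(2) by (auto simp: span_range_bit_eq_sums)
  then show ?thesis using assms(1) by (simp add: induced_map_lessThan_sum)
qed

lemma induced_map_zero: "induced_map \<sigma> \<alpha> 0 = 0"
  using induced_map_sum[of "{}"] by simp

lemma bij_betw_induced_map:
  assumes "bij \<sigma>"
  shows "bij_betw (induced_map \<sigma> \<alpha>) (vec.span (range \<alpha>)) (vec.span (range \<alpha>))"
proof (rule bij_betw_imageI)
  show "inj_on (induced_map \<sigma> \<alpha>) (vec.span (range \<alpha>))"
  proof (rule inj_onI)
    fix x y assume x: "x \<in> vec.span (range \<alpha>)" and y: "y \<in> vec.span (range \<alpha>)"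
      and eq: "induced_map \<sigma> \<alpha> x = induced_map \<sigma> \<alpha> y"
    obtain n :: nat and v where xy: "x + y = (\<Sum>i<n. \<alpha> (v i))"
      using vec.span_add[OF x y] by (auto simp: span_range_bit_eq_sums)
    have "(\<Sum>i<n. \<alpha> (\<sigma> (v i))) = 0"
      using eq induced_map_add[OF x y] by (simp add: xy induced_map_lessThan_sum)
    then have "x + y = 0"
      using extendible unfolding linearly_extendible_def xy by blast
    then show "x = y" by (simp add: vec_bit_add_eq_0_iff)
  qed
  show "induced_map \<sigma> \<alpha> ` vec.span (range \<alpha>) = vec.span (range \<alpha>)"
  proof (intro equalityI subsetI)
    fix y assume "y \<in> induced_map \<sigma> \<alpha> ` vec.span (range \<alpha>)"
    then obtain n :: nat and v where "y = induced_map \<sigma> \<alpha> (\<Sum>i<n. \<alpha> (v i))"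
      by (auto simp: span_range_bit_eq_sums)
    then show "y \<in> vec.span (range \<alpha>)"
      using sum_in_span_range[of \<alpha> "\<lambda>i. \<sigma> (v i)"] by (simp add: induced_map_lessThan_sum)
  next
    fix y assume "y \<in> vec.span (range \<alpha>)"
    then obtain n :: nat and u where y: "y = (\<Sum>i<n. \<alpha> (u i))"
      by (auto simp: span_range_bit_eq_sums)
    have "y = induced_map \<sigma> \<alpha> (\<Sum>i<n. \<alpha> (inv \<sigma> (u i)))"
      using assms by (simp add: y induced_map_lessThan_sum bij_is_surj surj_f_inv_f)
    moreover have "(\<Sum>i<n. \<alpha> (inv \<sigma> (u i))) \<in> vec.span (range \<alpha>)"
      by (rule sum_in_span_range)
    ultimately show "y \<in> induced_map \<sigma> \<alpha> ` vec.span (range \<alpha>)" by blast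
  qed
qed

end

locale direct_complement =
  fixes S U :: "('a::field ^ 'n) set"
  assumes subspace_S: "vec.subspace S" and subspace_U: "vec.subspace U"
    and disjoint: "S \<inter> U = {0}" and spanning: "vec.span (S \<union> U) = UNIV"
begin

lemma decompose: obtains s u where "s \<in> S" "u \<in> U" "w = s + u"
proof -
  have span_S: "vec.span S = S" and span_U: "vec.span U = U"
    using subspace_S subspace_U by (simp_all add: vec.span_eq_iff)
  have "w \<in> vec.span (S \<union> U)" using spanning by simp
  then have "w \<in> {s + u | s u. s \<in> S \<and> u \<in> U}"
    unfolding vec.span_Un span_S span_U .
  then show thesis using that by blast
qed

lemma decompose_unique:
  assumes "s \<in> S" "s' \<in> S" "u \<in> U" "u' \<in> U" "s + u = s' + u'"
  shows "s = s'" "u = u'"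
proof -
  have eq: "s - s' = u' - u" using assms(5) by (simp add: algebra_simps)
  have "s - s' \<in> S" using assms(1,2) subspace_S by (rule_tac vec.subspace_diff)
  moreover have "s - s' \<in> U" unfolding eq using assms(3,4) subspace_U by (rule_tac vec.subspace_diff)
  ultimately have "s - s' = 0" using disjoint by blast
  then show "s = s'" "u = u'" using eq by simp_all
qed

definition extend_by_id :: "('a ^ 'n \<Rightarrow> 'a ^ 'n) \<Rightarrow> 'a ^ 'n \<Rightarrow> 'a ^ 'n" where
  "extend_by_id f w = (THE y. \<exists>s\<in>S. \<exists>u\<in>U. w = s + u \<and> y = f s + u)"

lemma extend_by_id_eq:
  assumes "s \<in> S" "u \<in> U"
  shows "extend_by_id f (s + u) = f s + u"
  unfolding extend_by_id_def
proof (rule the_equality)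
  show "\<exists>s'\<in>S. \<exists>u'\<in>U. s + u = s' + u' \<and> f s + u = f s' + u'"
    using assms by blast
next
  fix y assume "\<exists>s'\<in>S. \<exists>u'\<in>U. s + u = s' + u' \<and> y = f s' + u'"
  then obtain s' u' where "s' \<in> S" "u' \<in> U" "s + u = s' + u'" "y = f s' + u'" by blast
  with decompose_unique[OF assms(1) \<open>s' \<in> S\<close> assms(2) \<open>u' \<in> U\<close>] show "y = f s + u"
    by simp
qed

lemma extend_by_id_on_S: "s \<in> S \<Longrightarrow> extend_by_id f s = f s"
  using extend_by_id_eq[of s 0] subspace_U by (simp add: vec.subspace_0)

lemma extend_by_id_unique:
  assumes "\<forall>s\<in>S. g s = f s" and "\<forall>s\<in>S. \<forall>u\<in>U. g (s + u) = g s + u"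
  shows "g = extend_by_id f"
proof
  fix w
  obtain s u where "s \<in> S" "u \<in> U" "w = s + u" by (rule decompose)
  then show "g w = extend_by_id f w" using assms by (simp add: extend_by_id_eq)
qed

lemma linear_extend_by_id:
  assumes add: "\<And>x y. x \<in> S \<Longrightarrow> y \<in> S \<Longrightarrow> f (x + y) = f x + f y"
    and scale: "\<And>c x. x \<in> S \<Longrightarrow> f (c *s x) = c *s f x"
  shows "Vector_Spaces.linear (*s) (*s) (extend_by_id f)"
proof -
  have "extend_by_id f (x + y) = extend_by_id f x + extend_by_id f y" for x y
  proof -
    obtain s u where su: "s \<in> S" "u \<in> U" "x = s + u" by (rule decompose)
    obtain s' u' where su': "s' \<in> S" "u' \<in> U" "y = s' + u'" by (rule decompose)
    have "s + s' \<in> S" "u + u' \<in> U"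
      using su su' subspace_S subspace_U by (auto intro: vec.subspace_add)
    have "extend_by_id f (x + y) = extend_by_id f ((s + s') + (u + u'))"
      using su su' by (simp add: ac_simps)
    also have "\<dots> = f (s + s') + (u + u')"
      by (rule extend_by_id_eq) fact+
    also have "\<dots> = extend_by_id f x + extend_by_id f y"
      using su su' by (simp add: extend_by_id_eq add ac_simps)
    finally show ?thesis .
  qed
  moreover have "extend_by_id f (c *s x) = c *s extend_by_id f x" for c x
  proof -
    obtain s u where su: "s \<in> S" "u \<in> U" "x = s + u" by (rule decompose)
    have "c *s x = c *s s + c *s u" using su by (simp add: vec.scale_right_distrib)
    moreover have "c *s s \<in> S" "c *s u \<in> U"
      using su subspace_S subspace_U by (auto intro: vec.subspace_scale)
    ultimately show ?thesis
      using su by (simp add: extend_by_id_eq scale vec.scale_right_distrib)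
  qed
  ultimately show ?thesis
    unfolding Vector_Spaces.linear_iff using vec.vector_space_axioms by blast
qed

lemma bij_extend_by_id:
  assumes "bij_betw f S S"
  shows "bij (extend_by_id f)"
proof (rule bijI)
  show "inj (extend_by_id f)"
  proof (rule injI)
    fix x y assume eq: "extend_by_id f x = extend_by_id f y"
    obtain s u where su: "s \<in> S" "u \<in> U" "x = s + u" by (rule decompose)
    obtain s' u' where su': "s' \<in> S" "u' \<in> U" "y = s' + u'" by (rule decompose)
    have "f s \<in> S" "f s' \<in> S" using su(1) su'(1) assms by (auto dest: bij_betwE)
    moreover have "f s + u = f s' + u'" using eq su su' by (simp add: extend_by_id_eq)
    ultimately have "f s = f s'" "u = u'"
      using decompose_unique su(2) su'(2) by simp_all
    moreover have "inj_on f S" using assms by (rule bij_betw_imp_inj_on)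
    ultimately show "x = y"
      using su su' by (simp add: inj_on_eq_iff)
  qed
  show "surj (extend_by_id f)"
    unfolding surj_def
  proof
    fix y
    obtain s u where su: "s \<in> S" "u \<in> U" "y = s + u" by (rule decompose)
    then obtain t where "t \<in> S" "s = f t" using assms unfolding bij_betw_def by blast
    then have "y = extend_by_id f (t + u)" using su by (simp add: extend_by_id_eq)
    then show "\<exists>x. y = extend_by_id f x" ..
  qed
qed

end

theorem mainTheorem2:
  fixes \<alpha> :: "bit ^ 'r \<Rightarrow> bit ^ 's"
    and \<sigma> :: "bit ^ 'r \<Rightarrow> bit ^ 'r"
    and T :: "(bit ^ 's) set"
    and B :: "(bit ^ 's) set"
  assumes "CARD('s) > CARD('r)"
    and "inj \<alpha>"
    and "bij \<sigma>"
    and "linearly_extendible \<sigma> \<alpha>"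
    and T_def: "T = vec.span (range \<alpha>)"
    and "B \<subseteq> cart_basis"
    and "card B = CARD('s) - vec.dim T"
    and "vec.span (T \<union> B) = UNIV"
    and "T \<inter> vec.span B = {0}"
  shows "\<exists>\<sigma>'. ((\<forall>(I::nat set) (v::nat \<Rightarrow> bit ^ 'r). finite I \<longrightarrow>
                 \<sigma>' (\<Sum>j\<in>I. \<alpha> (v j)) = (\<Sum>j\<in>I. \<alpha> (\<sigma> (v j))))
              \<and> (\<forall>t\<in>T. \<forall>b\<in>vec.span B. \<sigma>' (t + b) = \<sigma>' t + b))
           \<and> (\<forall>g. ((\<forall>(I::nat set) (v::nat \<Rightarrow> bit ^ 'r). finite I \<longrightarrow>
                      g (\<Sum>j\<in>I. \<alpha> (v j)) = (\<Sum>j\<in>I. \<alpha> (\<sigma> (v j))))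
                   \<and> (\<forall>t\<in>T. \<forall>b\<in>vec.span B. g (t + b) = g t + b)) \<longrightarrow> g = \<sigma>')
           \<and> Vector_Spaces.linear (*s) (*s) \<sigma>' \<and> bij \<sigma>'"
proof -
  have "UNIV \<subseteq> vec.span (T \<union> vec.span B)"
    unfolding assms(8)[symmetric] by (intro vec.span_mono) (auto intro: vec.span_base)
  then interpret direct_complement T "vec.span B"
    using assms(9) by unfold_locales (auto simp: T_def)
  let ?\<sigma>' = "extend_by_id (induced_map \<sigma> \<alpha>)"
  have on_sums: "\<forall>(I::nat set) v. finite I \<longrightarrow> ?\<sigma>' (\<Sum>j\<in>I. \<alpha> (v j)) = (\<Sum>j\<in>I. \<alpha> (\<sigma> (v j)))"
  proof (intro allI impI)
    fix I :: "nat set" and v :: "nat \<Rightarrow> bit ^ 'r"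
    assume "finite I"
    have "(\<Sum>j\<in>I. \<alpha> (v j)) \<in> T" unfolding T_def by (rule sum_in_span_range)
    with \<open>finite I\<close> assms(4) show "?\<sigma>' (\<Sum>j\<in>I. \<alpha> (v j)) = (\<Sum>j\<in>I. \<alpha> (\<sigma> (v j)))"
      by (simp add: extend_by_id_on_S induced_map_sum)
  qed
  have along_B: "\<forall>t\<in>T. \<forall>b\<in>vec.span B. ?\<sigma>' (t + b) = ?\<sigma>' t + b"
    by (simp add: extend_by_id_eq extend_by_id_on_S)
  have unique: "\<forall>g. ((\<forall>(I::nat set) v. finite I \<longrightarrow> g (\<Sum>j\<in>I. \<alpha> (v j)) = (\<Sum>j\<in>I. \<alpha> (\<sigma> (v j))))
                 \<and> (\<forall>t\<in>T. \<forall>b\<in>vec.span B. g (t + b) = g t + b)) \<longrightarrow> g = ?\<sigma>'"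
    by (intro allI impI, elim conjE, rule extend_by_id_unique)
      (auto simp: T_def intro: induced_map_unique_on_span[OF assms(4)])
  have linear: "Vector_Spaces.linear (*s) (*s) ?\<sigma>'"
    using assms(4) by (intro linear_extend_by_id vec_bit_scale_commute induced_map_add induced_map_zero)
      (simp_all add: T_def)
  have bij: "bij ?\<sigma>'"
    using assms(3,4) by (intro bij_extend_by_id) (simp add: T_def bij_betw_induced_map)
  show ?thesis
    by (intro exI[of _ ?\<sigma>'] conjI) fact+
qed

end
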